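(* Let $(X,\mathcal{T}_1,\mathcal{T}_2,E)$ be a bi-soft topological space over $X$ and let $Y$ be a non-empty subset of $X$. If $(X,\mathcal{T}_1,\mathcal{T}_2,E)$ is a pair-wise soft $T_2$-space, then $(Y,\mathcal{T}_{1Y},\mathcal{T}_{2Y},E)$ is also a pair-wise soft $T_2$-space.
   Context: $X$ is a set (initial universe) and $E$ is a non-empty set of parameters. A soft set $(F,E)$ over $X$ is a map $F:E\to\mathcal{P}(X)$, where $\mathcal{P}(X)$ is the power set of $X$. Unions and intersections of soft sets are taken parameterwise. $\Phi$ denotes the soft set with value $\emptyset$ at every $e\in E$ and $\widetilde{X}$ the soft set with value $X$ at every $e\in E$. For $x\in X$, $x\in(F,E)$ means $x\in F(e)$ for all $e\in E$. A soft topology on $X$ is a collection $\mathcal{T}$ of soft sets over $X$ (with parameter set $E$) containing $\Phi$ and $\widetilde{X}$ and closed under arbitrary unions and under intersections of two members; its members are called soft open. A bi-soft topological space $(X,\mathcal{T}_1,\mathcal{T}_2,E)$ consists of two soft topologies $\mathcal{T}_1,\mathcal{T}_2$ on $X$ with the same parameter set $E$. For a non-empty $Y\subseteq X$ and a soft set $(F,E)$ over $X$, $({}^YF,E)$ is the soft set with ${}^YF(e)=Y\cap F(e)$ for all $e\in E$. The soft relative topology is $\mathcal{T}_{iY}=\{({}^YF,E)\mid(F,E)\in\mathcal{T}_i\}$, a soft topology on $Y$, and $(Y,\mathcal{T}_{1Y},\mathcal{T}_{2Y},E)$ is the corresponding bi-soft topological space over $Y$. $(X,\mathcal{T}_1,\mathcal{T}_2,E)$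 is pair-wise soft $T_2$ (pair-wise soft Hausdorff) if for all $x,y\in X$ with $x\ne y$ there are $(F,E)\in\mathcal{T}_1$ and $(G,E)\in\mathcal{T}_2$ with $x\in(F,E)$, $y\in(G,E)$ and $(F,E)\cap(G,E)=\Phi$. *)

theory Defs
  imports "HOL-Library.FuncSet"
begin

text \<open>
  A soft set over \<open>X\<close> with parameter set \<open>E\<close> is a map from \<open>E\<close> to the power set of \<open>X\<close>.
  Maps on \<open>E\<close> are rendered by extensional functions, with value \<^const>\<open>undefined\<close> outside
  \<open>E\<close>, so that two soft sets are equal iff they agree at every parameter in \<open>E\<close>.  This is why
  the operations below are restricted to \<open>E\<close>.
\<close>

definition soft_sets :: "'a set \<Rightarrow> 'e set \<Rightarrow> ('e \<Rightarrow> 'a set) set" where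
  "soft_sets X E = E \<rightarrow>\<^sub>E Pow X"

definition soft_null :: "'e set \<Rightarrow> 'e \<Rightarrow> 'a set" where
  "soft_null E = (\<lambda>e\<in>E. {})"

definition soft_absolute :: "'a set \<Rightarrow> 'e set \<Rightarrow> 'e \<Rightarrow> 'a set" where
  "soft_absolute X E = (\<lambda>e\<in>E. X)"

definition soft_Union :: "'e set \<Rightarrow> ('e \<Rightarrow> 'a set) set \<Rightarrow> 'e \<Rightarrow> 'a set" where
  "soft_Union E \<F> = (\<lambda>e\<in>E. \<Union>F\<in>\<F>. F e)"

definition soft_inter :: "'e set \<Rightarrow> ('e \<Rightarrow> 'a set) \<Rightarrow> ('e \<Rightarrow> 'a set) \<Rightarrow> 'e \<Rightarrow> 'a set" where
  "soft_inter E F G = (\<lambda>e\<in>E. F e \<inter> G e)"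

definition soft_member :: "'e set \<Rightarrow> 'a \<Rightarrow> ('e \<Rightarrow> 'a set) \<Rightarrow> bool" where
  "soft_member E x F \<longleftrightarrow> (\<forall>e\<in>E. x \<in> F e)"

definition soft_topology :: "'a set \<Rightarrow> 'e set \<Rightarrow> ('e \<Rightarrow> 'a set) set \<Rightarrow> bool" where
  "soft_topology X E \<T> \<longleftrightarrow>
     \<T> \<subseteq> soft_sets X E \<and>
     soft_null E \<in> \<T> \<and>
     soft_absolute X E \<in> \<T> \<and>
     (\<forall>\<F>. \<F> \<subseteq> \<T> \<longrightarrow> soft_Union E \<F> \<in> \<T>) \<and>
     (\<forall>F\<in>\<T>. \<forall>G\<in>\<T>. soft_inter E F G \<in> \<T>)"

definition bi_soft_topological_space ::
  "'a set \<Rightarrow> ('e \<Rightarrow> 'a set) set \<Rightarrow> ('e \<Rightarrow> 'a set) set \<Rightarrow> 'e set \<Rightarrow> bool" where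
  "bi_soft_topological_space X \<T>\<^sub>1 \<T>\<^sub>2 E \<longleftrightarrow>
     E \<noteq> {} \<and> soft_topology X E \<T>\<^sub>1 \<and> soft_topology X E \<T>\<^sub>2"

definition soft_restriction :: "'a set \<Rightarrow> 'e set \<Rightarrow> ('e \<Rightarrow> 'a set) \<Rightarrow> 'e \<Rightarrow> 'a set" where
  "soft_restriction Y E F = (\<lambda>e\<in>E. Y \<inter> F e)"

definition soft_relative_topology ::
  "'a set \<Rightarrow> 'e set \<Rightarrow> ('e \<Rightarrow> 'a set) set \<Rightarrow> ('e \<Rightarrow> 'a set) set" where
  "soft_relative_topology Y E \<T> = {soft_restriction Y E F | F. F \<in> \<T>}"

definition pairwise_soft_T2_space ::
  "'a set \<Rightarrow> ('e \<Rightarrow> 'a set) set \<Rightarrow> ('e \<Rightarrow> 'a set) set \<Rightarrow> 'e set \<Rightarrow> bool" where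
  "pairwise_soft_T2_space X \<T>\<^sub>1 \<T>\<^sub>2 E \<longleftrightarrow>
     bi_soft_topological_space X \<T>\<^sub>1 \<T>\<^sub>2 E \<and>
     (\<forall>x\<in>X. \<forall>y\<in>X. x \<noteq> y \<longrightarrow>
        (\<exists>F\<in>\<T>\<^sub>1. \<exists>G\<in>\<T>\<^sub>2.
           soft_member E x F \<and> soft_member E y G \<and> soft_inter E F G = soft_null E))"

end

theory Submission
  imports Defs
begin

text \<open>
  Restricting a soft set to \<open>Y\<close> intersects each of its values with \<open>Y\<close>, so it commutes with
  arbitrary unions and with binary intersections, and it sends the null soft set to itself.
  Restricting all members of a soft topology on \<open>X\<close> to a subset \<open>Y\<close> therefore gives a soft
  topology on \<open>Y\<close> (\<open>soft_topology_relative\<close>).  For distinct points of \<open>Y\<close>, a separating pair of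
  soft open sets over \<open>X\<close> restricts to a separating pair over \<open>Y\<close>: a point of \<open>Y\<close> stays in the
  restriction of any soft set containing it, and the intersection of the restrictions is the
  restriction of the null soft set.
\<close>

lemma soft_relative_topology_eq_image:
  "soft_relative_topology Y E \<T> = soft_restriction Y E ` \<T>"
  unfolding soft_relative_topology_def by blast

lemma soft_restriction_in_soft_sets: "soft_restriction Y E F \<in> soft_sets Y E"
  unfolding soft_restriction_def soft_sets_def by auto

lemma soft_restriction_null: "soft_restriction Y E (soft_null E) = soft_null E"
  unfolding soft_restriction_def soft_null_def by (auto simp: fun_eq_iff)

lemma soft_restriction_absolute:
  assumes "Y \<subseteq> X"
  shows "soft_restriction Y E (soft_absolute X E) = soft_absolute Y E"
  using assms unfolding soft_restriction_def soft_absolute_def by (auto simp: fun_eq_iff)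

lemma soft_restriction_Union:
  "soft_restriction Y E (soft_Union E \<F>) = soft_Union E (soft_restriction Y E ` \<F>)"
  unfolding soft_restriction_def soft_Union_def by (auto simp: fun_eq_iff)

lemma soft_restriction_inter:
  "soft_restriction Y E (soft_inter E F G) =
     soft_inter E (soft_restriction Y E F) (soft_restriction Y E G)"
  unfolding soft_restriction_def soft_inter_def by (auto simp: fun_eq_iff)

lemma soft_member_restriction:
  assumes "x \<in> Y" and "soft_member E x F"
  shows "soft_member E x (soft_restriction Y E F)"
  using assms unfolding soft_member_def soft_restriction_def by auto

text \<open>
  Each closure property is the image under restriction of the same property of the original soft
  topology, because restriction commutes with the operation concerned.
\<close>

lemma soft_topology_relative:
  assumes "soft_topology X E \<T>" and "Y \<subseteq> X"
  shows "soft_topology Y E (soft_relative_topology Y E \<T>)"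
proof -
  let ?r = "soft_restriction Y E"
  have null: "soft_null E \<in> \<T>" and absolute: "soft_absolute X E \<in> \<T>"
    and Union: "\<And>\<F>. \<F> \<subseteq> \<T> \<Longrightarrow> soft_Union E \<F> \<in> \<T>"
    and inter: "\<And>F G. F \<in> \<T> \<Longrightarrow> G \<in> \<T> \<Longrightarrow> soft_inter E F G \<in> \<T>"
    using assms(1) unfolding soft_topology_def by blast+
  have "?r ` \<T> \<subseteq> soft_sets Y E"
    using soft_restriction_in_soft_sets by blast
  moreover have "soft_null E \<in> ?r ` \<T>"
    using imageI[OF null, of ?r] by (simp only: soft_restriction_null)
  moreover have "soft_absolute Y E \<in> ?r ` \<T>"
    using imageI[OF absolute, of ?r] by (simp only: soft_restriction_absolute[OF assms(2)])
  moreover have "soft_Union E \<F> \<in> ?r ` \<T>" if "\<F> \<subseteq> ?r ` \<T>" for \<F>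
  proof -
    from that obtain \<G> where "\<G> \<subseteq> \<T>" and \<F>: "\<F> = ?r ` \<G>"
      by (auto simp: subset_image_iff)
    then have "?r (soft_Union E \<G>) \<in> ?r ` \<T>"
      using Union by blast
    then show ?thesis
      by (simp only: soft_restriction_Union \<F>)
  qed
  moreover have "soft_inter E F G \<in> ?r ` \<T>" if "F \<in> ?r ` \<T>" and "G \<in> ?r ` \<T>" for F G
  proof -
    from that obtain F' G' where "F' \<in> \<T>" "G' \<in> \<T>" and FG: "F = ?r F'" "G = ?r G'"
      by blast
    then have "?r (soft_inter E F' G') \<in> ?r ` \<T>"
      using inter by blast
    then show ?thesis
      by (simp only: soft_restriction_inter FG)
  qed
  ultimately show ?thesis
    unfolding soft_topology_def soft_relative_topology_eq_image by blast
qed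

theorem proposition14:
  fixes X Y :: "'a set" and E :: "'e set" and \<T>\<^sub>1 \<T>\<^sub>2 :: "('e \<Rightarrow> 'a set) set"
  assumes "bi_soft_topological_space X \<T>\<^sub>1 \<T>\<^sub>2 E"
    and "Y \<noteq> {}" and "Y \<subseteq> X"
    and "pairwise_soft_T2_space X \<T>\<^sub>1 \<T>\<^sub>2 E"
  shows "pairwise_soft_T2_space Y
           (soft_relative_topology Y E \<T>\<^sub>1) (soft_relative_topology Y E \<T>\<^sub>2) E"
proof -
  let ?r = "soft_restriction Y E"
  have "bi_soft_topological_space Y
          (soft_relative_topology Y E \<T>\<^sub>1) (soft_relative_topology Y E \<T>\<^sub>2) E"
    using assms(1,3) soft_topology_relative unfolding bi_soft_topological_space_def by blast
  moreover have "\<exists>F\<in>?r ` \<T>\<^sub>1. \<exists>G\<in>?r ` \<T>\<^sub>2.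
      soft_member E x F \<and> soft_member E y G \<and> soft_inter E F G = soft_null E"
    if "x \<in> Y" "y \<in> Y" "x \<noteq> y" for x y
  proof -
    from that assms(3) have "x \<in> X" "y \<in> X" by auto
    with \<open>x \<noteq> y\<close> assms(4) obtain F G where "F \<in> \<T>\<^sub>1" "G \<in> \<T>\<^sub>2"
      and "soft_member E x F" "soft_member E y G" and disjoint: "soft_inter E F G = soft_null E"
      unfolding pairwise_soft_T2_space_def by blast
    moreover have "soft_inter E (?r F) (?r G) = soft_null E"
      by (simp only: soft_restriction_inter[symmetric] disjoint soft_restriction_null)
    ultimately show ?thesis
      using soft_member_restriction[OF \<open>x \<in> Y\<close>] soft_member_restriction[OF \<open>y \<in> Y\<close>] by blast
  qed
  ultimately show ?thesis
    unfolding pairwise_soft_T2_space_def soft_relative_topology_eq_image by blast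
qed

end
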